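(* Let $\{\mathbf e_n,\mathbf e_n^*\}_{n=1}^\infty$ be a seminormalized biorthogonal system in the Banach space $\mathbb X$ and let $\eta=\{\eta(j)\}_{j=1}^\infty$ be a positive non-decreasing sequence. Then the following are equivalent: (i) $\|\mathbf 1_{\varepsilon A}\|\le\eta(|A|)$ for all finite $A\subset\mathbb N$ and all $\varepsilon\in\Upsilon$. (ii) $\big\|\sum_n a_n\mathbf e_n\big\|\le\|\mathbf a\|_{\ell^1_{\widehat\eta}}$ for all $\mathbf a=\{a_n\}\in c_{00}$. Moreover, if $\mathcal B^*=\{\mathbf e_n^*\}$ is total, then each of (i) and (ii) is equivalent to (iii) $\ell^1_{\widehat\eta}$ embeds into $\mathbb X$ via $\mathcal B=\{\mathbf e_n\}$ with norm $1$; that is, for every $\mathbf s=\{s_n\}\in\ell^1_{\widehat\eta}$ there exists a unique $x\in\mathbb X$ with $\mathbf e_n^*(x)=s_n$ for all $n$, and it satisfies $\|x\|\le\|\mathbf s\|_{\ell^1_{\widehat\eta}}$.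
   Context: $(\mathbb X,\|\cdot\|)$ is a separable infinite-dimensional Banach space over $\mathbb K=\mathbb R$ or $\mathbb C$ with dual $(\mathbb X^*,\|\cdot\|_* )$. A system $\{\mathbf e_n,\mathbf e_n^*\}_{n=1}^\infty\subset\mathbb X\times\mathbb X^*$ is biorthogonal if $\mathbf e_n^*(\mathbf e_m)=\delta_{n,m}$, and seminormalized if there are $A,B\in(0,\infty)$ with $A\le\|\mathbf e_n\|,\|\mathbf e_n^*\|_*\le B$ for all $n$. $\mathcal B^*$ is total if $x=0$ is the only $x\in\mathbb X$ with $\mathbf e_n^*(x)=0$ for all $n$. $\Upsilon$ is the set of sequences $\varepsilon=\{\varepsilon_j\}\subset\mathbb K$ with $|\varepsilon_j|=1$ for all $j$; $\mathbf 1_{\varepsilon A}=\sum_{j\in A}\varepsilon_j\mathbf e_j$. $c_{00}$ is the space of finitely supported scalar sequences. For $\mathbf s\in c_0$, $\{s_j^*\}_{j\ge1}$ is the non-increasing rearrangement of $\{|s_n|\}$. With $\Delta\eta(j)=\eta(j)-\eta(j-1)$, $\eta(0)=0$, and $\widehat\eta(j)=j\Delta\eta(j)$, the set $\ell^1_{\widehat\eta}$ consists of all $\mathbf s\in c_0$ with $\|\mathbf s\|_{\ell^1_{\widehat\eta}}:=\sum_{j=1}^\infty s_j^*\,\Delta\eta(j)<\infty$. *)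

theory Defs
  imports "HOL-Analysis.Analysis"
begin

text \<open>
  The scalar field is a type \<open>'k\<close> of class \<^class>\<open>real_normed_field\<close>: a field that is a real
  algebra with multiplicative norm. By the Gelfand--Mazur theorem these are, up to isometric
  isomorphism, exactly the real and the complex numbers. As the library only has normed spaces over
  the reals, the scalar multiplication of the Banach space is an explicit parameter \<open>smul\<close>; the
  additive, metric and (real) norm structure come from the class \<^class>\<open>banach\<close>.
\<close>

locale normed_space_over = vector_space smul
  for smul :: "'k::real_normed_field \<Rightarrow> 'a::real_normed_vector \<Rightarrow> 'a" +
  assumes norm_scale: "norm (smul c x) = norm c * norm x"
    and scale_of_real: "smul (of_real r) x = r *\<^sub>R x"

lemma normed_space_over_scaleR:
  "normed_space_over (scaleR :: real \<Rightarrow> 'a::real_normed_vector \<Rightarrow> 'a)"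
  by unfold_locales (auto simp: algebra_simps)

lemma normed_space_over_complex: "normed_space_over ((*) :: complex \<Rightarrow> complex \<Rightarrow> complex)"
  by unfold_locales (auto simp: algebra_simps norm_mult scaleR_conv_of_real)

definition separable_infinite_dim_space ::
  "('k::real_normed_field \<Rightarrow> 'a::real_normed_vector \<Rightarrow> 'a) \<Rightarrow> bool" where
  "separable_infinite_dim_space smul \<longleftrightarrow>
     normed_space_over smul \<and>
     separable_space (euclidean :: 'a topology) \<and>
     \<not> (\<exists>B. finite B \<and> module.span smul B = UNIV)"

text \<open>
  Bounded real-linear maps into \<open>'k\<close> that are homogeneous over \<open>'k\<close>. The norm of the type
  \<open>'a \<Rightarrow>\<^sub>L 'k\<close> is the operator norm, that is, the dual norm.
\<close>

definition dual_space ::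
  "('k::real_normed_field \<Rightarrow> 'a::real_normed_vector \<Rightarrow> 'a) \<Rightarrow> ('a \<Rightarrow>\<^sub>L 'k) set" where
  "dual_space smul = {f. \<forall>c x. blinfun_apply f (smul c x) = c * blinfun_apply f x}"

text \<open>Systems of vectors and scalar sequences are indexed by all of \<^typ>\<open>nat\<close>, starting at \<open>0\<close>.\<close>

definition biorthogonal_system ::
  "('k::real_normed_field \<Rightarrow> 'a::real_normed_vector \<Rightarrow> 'a)
     \<Rightarrow> (nat \<Rightarrow> 'a) \<Rightarrow> (nat \<Rightarrow> 'a \<Rightarrow>\<^sub>L 'k) \<Rightarrow> bool" where
  "biorthogonal_system smul e e' \<longleftrightarrow>
     (\<forall>n. e' n \<in> dual_space smul) \<and>
     (\<forall>n m. blinfun_apply (e' n) (e m) = (if n = m then 1 else 0))"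

definition seminormalized ::
  "(nat \<Rightarrow> 'a::real_normed_vector) \<Rightarrow> (nat \<Rightarrow> 'a \<Rightarrow>\<^sub>L 'k::real_normed_field) \<Rightarrow> bool" where
  "seminormalized e e' \<longleftrightarrow>
     (\<exists>A B. 0 < A \<and> 0 < B \<and>
        (\<forall>n. A \<le> norm (e n) \<and> norm (e n) \<le> B \<and> A \<le> norm (e' n) \<and> norm (e' n) \<le> B))"

definition total_functionals ::
  "(nat \<Rightarrow> 'a::real_normed_vector \<Rightarrow>\<^sub>L 'k::real_normed_field) \<Rightarrow> bool" where
  "total_functionals e' \<longleftrightarrow> (\<forall>x. (\<forall>n. blinfun_apply (e' n) x = 0) \<longrightarrow> x = 0)"

definition unimodular_sequences :: "(nat \<Rightarrow> 'k::real_normed_field) set" where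
  "unimodular_sequences = {\<epsilon>. \<forall>j. norm (\<epsilon> j) = 1}"

definition indicator_sum ::
  "('k::real_normed_field \<Rightarrow> 'a::real_normed_vector \<Rightarrow> 'a)
     \<Rightarrow> (nat \<Rightarrow> 'a) \<Rightarrow> (nat \<Rightarrow> 'k) \<Rightarrow> nat set \<Rightarrow> 'a" where
  "indicator_sum smul e \<epsilon> A = (\<Sum>j\<in>A. smul (\<epsilon> j) (e j))"

definition c0_space :: "(nat \<Rightarrow> 'k::real_normed_field) set" where
  "c0_space = {s. s \<longlonglongrightarrow> 0}"

definition c00_space :: "(nat \<Rightarrow> 'k::real_normed_field) set" where
  "c00_space = {s. finite {n. s n \<noteq> 0}}"

definition finite_expansion ::
  "('k::real_normed_field \<Rightarrow> 'a::real_normed_vector \<Rightarrow> 'a)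
     \<Rightarrow> (nat \<Rightarrow> 'a) \<Rightarrow> (nat \<Rightarrow> 'k) \<Rightarrow> 'a" where
  "finite_expansion smul e a = (\<Sum>n\<in>{n. a n \<noteq> 0}. smul (a n) (e n))"

text \<open>
  The non-increasing rearrangement via the distribution function:
  \<open>s\<^sup>*\<^sub>j = inf {t \<ge> 0. #{n. |s\<^sub>n| > t} < j}\<close>. It is indexed by \<open>j \<ge> 1\<close>; the value at \<open>j = 0\<close> is
  irrelevant. The finiteness condition is needed since \<^const>\<open>card\<close> is \<open>0\<close> on infinite sets.
\<close>

definition decreasing_rearrangement :: "(nat \<Rightarrow> 'k::real_normed_field) \<Rightarrow> nat \<Rightarrow> real" where
  "decreasing_rearrangement s j =
     Inf {t. 0 \<le> t \<and> finite {n. t < norm (s n)} \<and> card {n. t < norm (s n)} < j}"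

lemma finite_norm_gt_c0:
  assumes "s \<in> c0_space" and "0 < t"
  shows "finite {n. t < norm (s n)}"
proof -
  have "eventually (\<lambda>n. norm (s n) < t) sequentially"
    using assms order_tendstoD(2)[of "\<lambda>n. norm (s n)" 0 sequentially t]
    by (auto simp: c0_space_def tendsto_norm_zero_iff)
  then obtain N where "\<And>n. n \<ge> N \<Longrightarrow> norm (s n) < t"
    by (auto simp: eventually_sequentially)
  then have "{n. t < norm (s n)} \<subseteq> {..<N}"
    by (force simp: not_less[symmetric])
  then show ?thesis
    using finite_subset by blast
qed

text \<open>
  The rearrangement exceeds \<open>t > 0\<close> at exactly as many indices \<open>j \<ge> 1\<close> as \<open>|s\<^sub>n|\<close> does.
\<close>

lemma less_decreasing_rearrangement_iff:
  assumes s: "s \<in> c0_space" and t: "0 < t" and j: "1 \<le> j"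
  shows "t < decreasing_rearrangement s j \<longleftrightarrow> j \<le> card {n. t < norm (s n)}"
proof -
  define D where "D u = {n. u < norm (s n)}" for u
  define S where "S = {u. 0 \<le> u \<and> finite (D u) \<and> card (D u) < j}"
  have eq: "decreasing_rearrangement s j = Inf S"
    by (simp add: decreasing_rearrangement_def S_def D_def)
  have bdd: "bdd_below S"
    by (rule bdd_belowI[of _ 0]) (simp add: S_def)
  have fin: "finite (D t)"
    using finite_norm_gt_c0[OF s t] by (simp add: D_def)
  have "t < Inf S" if jt: "j \<le> card (D t)"
  proof -
    have "Bseq s"
      using s by (auto simp: c0_space_def intro!: convergent_imp_Bseq convergentI)
    then obtain K where "0 < K" "\<And>n. norm (s n) \<le> K"
      by (auto simp: Bseq_def)
    then have "D K = {}"
      by (auto simp: D_def not_less)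
    then have "K \<in> S"
      using j \<open>0 < K\<close> by (simp add: S_def)
    then have ne: "S \<noteq> {}"
      by blast
    have Dne: "D t \<noteq> {}"
      using jt j by auto
    define m where "m = Min ((\<lambda>n. norm (s n)) ` D t)"
    have "t < m"
      using fin Dne by (auto simp: m_def D_def)
    moreover have "m \<le> u" if u: "u \<in> S" for u
    proof -
      have "\<not> D t \<subseteq> D u"
        using u jt card_mono[of "D u" "D t"] by (auto simp: S_def)
      then obtain n where "n \<in> D t" "norm (s n) \<le> u"
        unfolding D_def by (auto simp flip: not_le)
      moreover from \<open>n \<in> D t\<close> have "m \<le> norm (s n)"
        using fin by (simp add: m_def)
      ultimately show ?thesis
        by linarith
    qed
    then have "m \<le> Inf S"
      using ne by (intro cInf_greatest) auto
    ultimately show ?thesis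
      by linarith
  qed
  moreover have "Inf S \<le> t" if "card (D t) < j"
    using that t fin bdd by (intro cInf_lower) (auto simp: S_def)
  ultimately show ?thesis
    unfolding eq D_def[symmetric] by (meson not_less)
qed

definition backward_difference :: "(nat \<Rightarrow> real) \<Rightarrow> nat \<Rightarrow> real" where
  "backward_difference \<eta> j = \<eta> j - \<eta> (j - 1)"

text \<open>
  The space \<open>\<ell>\<^sup>1\<close> with weight \<open>j * backward_difference \<eta> j\<close>. Its norm is a sum over \<open>j \<ge> 1\<close>, hence the
  shift by \<^const>\<open>Suc\<close> in the terms.
\<close>

definition weighted_l1_term ::
  "(nat \<Rightarrow> real) \<Rightarrow> (nat \<Rightarrow> 'k::real_normed_field) \<Rightarrow> nat \<Rightarrow> real" where
  "weighted_l1_term \<eta> s i = decreasing_rearrangement s (Suc i) * backward_difference \<eta> (Suc i)"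

definition weighted_l1_space :: "(nat \<Rightarrow> real) \<Rightarrow> (nat \<Rightarrow> 'k::real_normed_field) set" where
  "weighted_l1_space \<eta> = {s \<in> c0_space. summable (weighted_l1_term \<eta> s)}"

definition weighted_l1_norm :: "(nat \<Rightarrow> real) \<Rightarrow> (nat \<Rightarrow> 'k::real_normed_field) \<Rightarrow> real" where
  "weighted_l1_norm \<eta> s = (\<Sum>i. weighted_l1_term \<eta> s i)"

definition embeds_with_norm_one ::
  "(nat \<Rightarrow> real) \<Rightarrow> (nat \<Rightarrow> 'a::real_normed_vector \<Rightarrow>\<^sub>L 'k::real_normed_field) \<Rightarrow> bool" where
  "embeds_with_norm_one \<eta> e' \<longleftrightarrow>
     (\<forall>s\<in>weighted_l1_space \<eta>.
        (\<exists>!x. \<forall>n. blinfun_apply (e' n) x = s n) \<and>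
        (\<forall>x. (\<forall>n. blinfun_apply (e' n) x = s n) \<longrightarrow> norm x \<le> weighted_l1_norm \<eta> s))"

end

theory Submission
  imports Defs
begin

text \<open>
  For (i) \<open>\<Longrightarrow>\<close> (ii), peel layers off a finitely supported sequence \<open>a\<close>: if \<open>m\<close> is the least nonzero
  value of \<open>|a\<^sub>n|\<close> and \<open>A\<close> is the support, subtracting \<open>m sgn(a\<^sub>n)\<close> shrinks the support and lowers the
  first \<open>|A|\<close> terms of the rearrangement by \<open>m\<close>, which changes the weighted norm by \<open>m \<eta>(|A|)\<close>.
  For (ii) \<open>\<Longrightarrow>\<close> (iii), the rearrangements of the tails of \<open>s\<close> are dominated by that of \<open>s\<close> and tend to
  \<open>0\<close> pointwise, so by dominated convergence the partial sums \<open>\<Sum>\<^sub>n\<^sub><\<^sub>N s\<^sub>n e\<^sub>n\<close> are Cauchy.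
\<close>

section \<open>The non-increasing rearrangement\<close>

lemma decreasing_rearrangement_le:
  assumes "0 \<le> t" "finite {n. t < norm (s n)}" "card {n. t < norm (s n)} < j"
  shows "decreasing_rearrangement s j \<le> t"
  unfolding decreasing_rearrangement_def
  using assms by (intro cInf_lower bdd_belowI[of _ 0]) auto

text \<open>The infimum of the empty set of reals carries no information, so every lower bound for,
  or comparison of, rearrangements starts here. A bound on the sequence is a candidate because its
  level set is empty; this takes \<open>1 \<le> j\<close>.\<close>

lemma decreasing_rearrangement_candidates_nonempty:
  assumes "Bseq s" "1 \<le> j"
  shows "{t. 0 \<le> t \<and> finite {n. t < norm (s n)} \<and> card {n. t < norm (s n)} < j} \<noteq> {}"
proof -
  obtain K where K: "0 < K" "\<And>n. norm (s n) \<le> K"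
    using assms by (auto simp: Bseq_def)
  then have "{n. K < norm (s n)} = {}"
    by (auto simp: not_less)
  then have "0 \<le> K \<and> finite {n. K < norm (s n)} \<and> card {n. K < norm (s n)} < j"
    using K assms by simp
  then show ?thesis
    by blast
qed

lemma decreasing_rearrangement_nonneg:
  assumes "Bseq s" "1 \<le> j"
  shows "0 \<le> decreasing_rearrangement s j"
  unfolding decreasing_rearrangement_def
  using decreasing_rearrangement_candidates_nonempty[OF assms] by (intro cInf_greatest) auto

text \<open>Level sets of \<open>s\<close> lie inside those of \<open>s'\<close>, so every candidate
  threshold for \<open>s'\<close> is one for \<open>s\<close>, and an infimum over more candidates
  is smaller. The finiteness clause passes to subsets as well.\<close>

lemma decreasing_rearrangement_mono:
  assumes s': "Bseq s'" and le: "\<And>n. norm (s n) \<le> norm (s' n)" and j: "1 \<le> j"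
  shows "decreasing_rearrangement s j \<le> decreasing_rearrangement s' j"
  unfolding decreasing_rearrangement_def
proof (intro cInf_superset_mono subsetI)
  fix t assume "t \<in> {t. 0 \<le> t \<and> finite {n. t < norm (s' n)} \<and> card {n. t < norm (s' n)} < j}"
  then have t: "0 \<le> t" "finite {n. t < norm (s' n)}" "card {n. t < norm (s' n)} < j"
    by auto
  have sub: "{n. t < norm (s n)} \<subseteq> {n. t < norm (s' n)}"
    using le by (auto intro: less_le_trans)
  show "t \<in> {t. 0 \<le> t \<and> finite {n. t < norm (s n)} \<and> card {n. t < norm (s n)} < j}"
    using t finite_subset[OF sub] card_mono[OF _ sub] by auto
qed (use decreasing_rearrangement_candidates_nonempty[OF s' j] in \<open>auto intro: bdd_belowI[of _ 0]\<close>)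

lemma c0_space_Bseq: "s \<in> c0_space \<Longrightarrow> Bseq s"
  by (auto simp: c0_space_def intro!: convergent_imp_Bseq convergentI)

lemma c00_space_subset_c0_space: "c00_space \<subseteq> c0_space"
proof
  fix s :: "nat \<Rightarrow> 'k::real_normed_field"
  assume "s \<in> c00_space"
  then have "eventually (\<lambda>n. s n = 0) sequentially"
    by (simp add: c00_space_def eventually_cofinite flip: cofinite_eq_sequentially)
  then show "s \<in> c0_space"
    by (simp add: c0_space_def tendsto_eventually)
qed

text \<open>The new case is \<open>t = 0\<close>: finite support keeps the level set at 0 finite, so
  its \<open>card\<close> is the true count. Peeling needs this case, since a threshold equal to the
  peeled height becomes 0.\<close>

lemma less_decreasing_rearrangement_iff_c00:
  assumes s: "s \<in> c00_space" and t: "0 \<le> t" and j: "1 \<le> j"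
  shows "t < decreasing_rearrangement s j \<longleftrightarrow> j \<le> card {n. t < norm (s n)}"
proof (cases "t = 0")
  case False
  then show ?thesis
    using less_decreasing_rearrangement_iff[of s t j] s t j c00_space_subset_c0_space by auto
next
  case True
  have c0: "s \<in> c0_space"
    using s c00_space_subset_c0_space by blast
  have fin: "finite {n. 0 < norm (s n)}"
    using s by (simp add: c00_space_def)
  have "0 < decreasing_rearrangement s j" if "j \<le> card {n. 0 < norm (s n)}"
  proof -
    let ?D = "{n. 0 < norm (s n)}"
    define m where "m = Min ((\<lambda>n. norm (s n)) ` ?D)"
    have "?D \<noteq> {}"
      using that j by (metis card.empty not_one_le_zero order_trans)
    then have "0 < m"
      unfolding m_def using fin by (subst Min_gr_iff) auto
    \<comment> \<open>Half the least nonzero modulus is a positive threshold that still lies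
      strictly below every nonzero value, so the criterion for positive thresholds applies to
      it.\<close>
    have "m / 2 < norm (s n)" if "n \<in> ?D" for n
    proof -
      have "m \<le> norm (s n)"
        using fin that unfolding m_def by (intro Min_le) auto
      with \<open>0 < m\<close> show ?thesis by linarith
    qed
    then have "?D \<subseteq> {n. m / 2 < norm (s n)}"
      by blast
    then have "j \<le> card {n. m / 2 < norm (s n)}"
      using that \<open>0 < m\<close> finite_norm_gt_c0[OF c0, of "m / 2"] card_mono order_trans
      by (metis half_gt_zero)
    then have "m / 2 < decreasing_rearrangement s j"
      using less_decreasing_rearrangement_iff[OF c0 _ j, of "m / 2"] \<open>0 < m\<close> by simp
    with \<open>0 < m\<close> show ?thesis by linarith
  qed
  then show ?thesis
    using True fin decreasing_rearrangement_le[of 0 s j] by (meson leI not_le order_refl)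
qed

lemma decreasing_rearrangement_eq_0_c00:
  assumes "s \<in> c00_space" "card {n. s n \<noteq> 0} < j"
  shows "decreasing_rearrangement s j = 0"
proof -
  have "decreasing_rearrangement s j \<le> 0"
    using assms by (intro decreasing_rearrangement_le) (auto simp: c00_space_def)
  moreover have "0 \<le> decreasing_rearrangement s j"
    using assms c00_space_subset_c0_space
    by (intro decreasing_rearrangement_nonneg c0_space_Bseq) auto
  ultimately show ?thesis by simp
qed

text \<open>For \<open>t \<ge> m\<close> the level set of \<open>a\<close> at \<open>t\<close> is
  that of \<open>b\<close> at \<open>t - m\<close>. Both sides of the claim are at least
  \<open>m\<close>, so comparing them with such thresholds decides equality.\<close>

lemma decreasing_rearrangement_peel:
  assumes a: "a \<in> c00_space" and b: "b \<in> c00_space" and m: "0 < m"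
    and ge: "\<And>n. a n \<noteq> 0 \<Longrightarrow> m \<le> norm (a n)"
    and nb: "\<And>n. norm (b n) = (if a n = 0 then 0 else norm (a n) - m)"
    and j: "1 \<le> j" "j \<le> card {n. a n \<noteq> 0}"
  shows "decreasing_rearrangement a j = decreasing_rearrangement b j + m"
proof -
  have b0: "0 \<le> decreasing_rearrangement b j"
    using b j c00_space_subset_c0_space by (intro decreasing_rearrangement_nonneg c0_space_Bseq) auto
  have a0: "m \<le> decreasing_rearrangement a j"
  \<comment> \<open>Thresholds strictly below \<open>m\<close> have the whole support as level set;
    at \<open>m\<close> itself the entries of modulus exactly \<open>m\<close> would drop
    out.\<close>
  proof (rule dense_le_bounded[OF m])
    fix t assume t: "0 < t" "t < m"
    then have "{n. t < norm (a n)} = {n. a n \<noteq> 0}"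
      using ge by force
    then show "t \<le> decreasing_rearrangement a j"
      using less_decreasing_rearrangement_iff_c00[OF a, of t j] t j by simp
  qed
  have "t < decreasing_rearrangement a j \<longleftrightarrow> t < decreasing_rearrangement b j + m" if "m \<le> t" for t
  proof -
    have "{n. t < norm (a n)} = {n. t - m < norm (b n)}"
      using that m by (auto simp: nb)
    then show ?thesis
      using less_decreasing_rearrangement_iff_c00[OF a, of t j]
        less_decreasing_rearrangement_iff_c00[OF b, of "t - m" j] that m j by (simp add: algebra_simps)
  qed
  \<comment> \<open>Each side, taken as the threshold \<open>t\<close>, is not below itself, hence
    not below the other; this yields both inequalities.\<close>
  from this[of "decreasing_rearrangement a j"] this[of "decreasing_rearrangement b j + m"] a0 b0
  show ?thesis by force
qed

lemma sum_backward_difference: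
  assumes "\<eta> 0 = 0"
  shows "(\<Sum>i<N. backward_difference \<eta> (Suc i)) = \<eta> N"
  using assms by (induction N) (auto simp: backward_difference_def)

text \<open>Once all remaining entries have modulus below \<open>u / 2\<close>, the level set of the
  tail at \<open>u / 2\<close> is empty, so \<open>u / 2\<close> bounds its rearrangement and leaves
  room for a strict inequality.\<close>

lemma decreasing_rearrangement_tendsto_0:
  assumes s: "s \<in> c0_space" and j: "1 \<le> j"
  shows "(\<lambda>N. decreasing_rearrangement (\<lambda>n. if n < N then 0 else s n) j) \<longlonglongrightarrow> 0"
proof (rule order_tendstoI)
  have bs: "Bseq (\<lambda>n. if n < N then 0 else s n)" for N
    by (rule Bseq_eventually_mono[OF _ c0_space_Bseq[OF s]]) auto
  fix u :: real
  show "eventually (\<lambda>N. u < decreasing_rearrangement (\<lambda>n. if n < N then 0 else s n) j) sequentially"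
    if "u < 0"
    using that decreasing_rearrangement_nonneg[OF bs j] by (auto intro: always_eventually less_le_trans)
  show "eventually (\<lambda>N. decreasing_rearrangement (\<lambda>n. if n < N then 0 else s n) j < u) sequentially"
    if u: "0 < u"
  proof -
    have "eventually (\<lambda>n. norm (s n) < u / 2) sequentially"
      using s u order_tendstoD(2)[of "\<lambda>n. norm (s n)" 0 sequentially "u / 2"]
      by (auto simp: c0_space_def tendsto_norm_zero_iff)
    then obtain N0 where N0: "\<And>n. n \<ge> N0 \<Longrightarrow> norm (s n) < u / 2"
      by (auto simp: eventually_sequentially)
    have "decreasing_rearrangement (\<lambda>n. if n < N then 0 else s n) j < u" if "N \<ge> N0" for N
    proof -
      have "{n. u / 2 < norm (if n < N then 0 else s n)} = {}"
        using N0 that u by (force simp: not_less intro: less_imp_le)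
      then have "decreasing_rearrangement (\<lambda>n. if n < N then 0 else s n) j \<le> u / 2"
        using u j by (intro decreasing_rearrangement_le) auto
      with u show ?thesis by linarith
    qed
    then show ?thesis
      by (auto simp: eventually_sequentially)
  qed
qed

section \<open>The weighted norm\<close>

lemma weighted_l1_term_eq_0_c00:
  assumes "a \<in> c00_space" "card {n. a n \<noteq> 0} \<le> i"
  shows "weighted_l1_term \<eta> a i = 0"
  using decreasing_rearrangement_eq_0_c00[of a "Suc i"] assms by (simp add: weighted_l1_term_def)

lemma c00_space_subset_weighted_l1_space: "c00_space \<subseteq> weighted_l1_space \<eta>"
proof
  fix a :: "nat \<Rightarrow> 'k::real_normed_field"
  assume a: "a \<in> c00_space"
  have "summable (weighted_l1_term \<eta> a)"
    by (rule summable_finite[of "{..<card {n. a n \<noteq> 0}}"])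
      (use weighted_l1_term_eq_0_c00[OF a] in auto)
  then show "a \<in> weighted_l1_space \<eta>"
    using a c00_space_subset_c0_space by (auto simp: weighted_l1_space_def)
qed

text \<open>Any \<open>N\<close> beyond the support size is allowed, so that sequences with
  different supports can be summed over a common range.\<close>

lemma weighted_l1_norm_c00:
  assumes "a \<in> c00_space" "card {n. a n \<noteq> 0} \<le> N"
  shows "weighted_l1_norm \<eta> a = (\<Sum>i<N. weighted_l1_term \<eta> a i)"
  unfolding weighted_l1_norm_def
  by (rule suminf_finite) (use assms weighted_l1_term_eq_0_c00[OF assms(1)] in auto)

lemma weighted_l1_norm_peel:
  assumes a: "a \<in> c00_space" and b: "b \<in> c00_space" and m: "0 < m"
    and ge: "\<And>n. a n \<noteq> 0 \<Longrightarrow> m \<le> norm (a n)"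
    and nb: "\<And>n. norm (b n) = (if a n = 0 then 0 else norm (a n) - m)"
    and \<eta>: "\<eta> 0 = 0"
  shows "weighted_l1_norm \<eta> a = weighted_l1_norm \<eta> b + m * \<eta> (card {n. a n \<noteq> 0})"
proof -
  let ?N = "card {n. a n \<noteq> 0}"
  \<comment> \<open>The support of \<open>b\<close> lies in that of \<open>a\<close>, so both series
    may be cut off at \<open>?N\<close>; the added multiples of \<open>m\<close> then
    telescope.\<close>
  have "b n = 0" if "a n = 0" for n
    using nb[of n] that by simp
  then have "{n. b n \<noteq> 0} \<subseteq> {n. a n \<noteq> 0}"
    by auto
  then have cb: "card {n. b n \<noteq> 0} \<le> ?N"
    using a by (intro card_mono) (auto simp: c00_space_def)
  have "weighted_l1_norm \<eta> a = (\<Sum>i<?N. weighted_l1_term \<eta> a i)"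
    using a by (simp add: weighted_l1_norm_c00)
  also have "\<dots> = (\<Sum>i<?N. weighted_l1_term \<eta> b i + m * backward_difference \<eta> (Suc i))"
  proof (rule sum.cong)
    fix i assume "i \<in> {..<?N}"
    then have "decreasing_rearrangement a (Suc i) = decreasing_rearrangement b (Suc i) + m"
      by (intro decreasing_rearrangement_peel[OF a b m ge nb]) auto
    then show "weighted_l1_term \<eta> a i = weighted_l1_term \<eta> b i + m * backward_difference \<eta> (Suc i)"
      by (simp add: weighted_l1_term_def algebra_simps)
  qed simp
  also have "\<dots> = weighted_l1_norm \<eta> b + m * \<eta> ?N"
    using b cb by (simp add: sum.distrib weighted_l1_norm_c00 sum_backward_difference \<eta>
        flip: sum_distrib_left)
  finally show ?thesis .
qed

text \<open>A single peeling with \<open>m = 1\<close> removes all entries at once and leaves the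
  zero sequence.\<close>

lemma weighted_l1_norm_const_on:
  assumes "finite A" "\<epsilon> \<in> unimodular_sequences" "\<eta> 0 = 0"
  shows "weighted_l1_norm \<eta> (\<lambda>n. if n \<in> A then \<epsilon> n else 0) = \<eta> (card A)"
proof -
  let ?a = "\<lambda>n. if n \<in> A then \<epsilon> n else 0"
  have nz: "\<epsilon> n \<noteq> 0" for n
    using assms(2) by (auto simp: unimodular_sequences_def dest: spec[of _ n])
  then have supp: "{n. ?a n \<noteq> 0} = A"
    by auto
  have "weighted_l1_norm \<eta> ?a = weighted_l1_norm \<eta> (\<lambda>n. 0::'a) + 1 * \<eta> (card {n. ?a n \<noteq> 0})"
    by (rule weighted_l1_norm_peel)
      (use assms supp in \<open>auto simp: c00_space_def unimodular_sequences_def split: if_splits\<close>)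
  moreover have "weighted_l1_norm \<eta> (\<lambda>n. 0::'a) = 0"
    by (subst weighted_l1_norm_c00[where N = 0]) (auto simp: c00_space_def)
  ultimately show ?thesis
    by (simp only: supp)
qed

section \<open>Monotonicity of the weighted norm, and its decay along tails\<close>

lemma weighted_l1_term_nonneg:
  assumes "Bseq s" "\<And>j. 1 \<le> j \<Longrightarrow> 0 \<le> backward_difference \<eta> j"
  shows "0 \<le> weighted_l1_term \<eta> s i"
  using assms by (simp add: weighted_l1_term_def decreasing_rearrangement_nonneg)

lemma weighted_l1_term_mono:
  assumes "Bseq s'" "\<And>n. norm (s n) \<le> norm (s' n)" "\<And>j. 1 \<le> j \<Longrightarrow> 0 \<le> backward_difference \<eta> j"
  shows "weighted_l1_term \<eta> s i \<le> weighted_l1_term \<eta> s' i"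
  using assms by (auto simp: weighted_l1_term_def intro!: mult_right_mono decreasing_rearrangement_mono)

lemma weighted_l1_space_mono:
  assumes s': "s' \<in> weighted_l1_space \<eta>" and le: "\<And>n. norm (s n) \<le> norm (s' n)"
    and \<eta>: "\<And>j. 1 \<le> j \<Longrightarrow> 0 \<le> backward_difference \<eta> j"
  shows "s \<in> weighted_l1_space \<eta>" "weighted_l1_norm \<eta> s \<le> weighted_l1_norm \<eta> s'"
proof -
  have c0': "s' \<in> c0_space" and sum': "summable (weighted_l1_term \<eta> s')"
    using s' by (auto simp: weighted_l1_space_def)
  have c0: "s \<in> c0_space"
    using c0' le by (auto simp: c0_space_def intro: Lim_null_comparison[where g = "\<lambda>n. norm (s' n)"]
        tendsto_norm_zero)
  have mono: "weighted_l1_term \<eta> s i \<le> weighted_l1_term \<eta> s' i" for i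
    by (rule weighted_l1_term_mono[OF c0_space_Bseq[OF c0'] le \<eta>])
  have sum: "summable (weighted_l1_term \<eta> s)"
    by (rule summable_comparison_test'[OF sum', of 0])
      (use mono weighted_l1_term_nonneg[OF c0_space_Bseq[OF c0] \<eta>] in auto)
  show "s \<in> weighted_l1_space \<eta>"
    using c0 sum by (simp add: weighted_l1_space_def)
  show "weighted_l1_norm \<eta> s \<le> weighted_l1_norm \<eta> s'"
    unfolding weighted_l1_norm_def by (rule suminf_le[OF mono sum sum'])
qed

lemma weighted_l1_norm_tail_tendsto_0:
  assumes s: "s \<in> weighted_l1_space \<eta>" and \<eta>: "\<And>j. 1 \<le> j \<Longrightarrow> 0 \<le> backward_difference \<eta> j"
  shows "(\<lambda>N. weighted_l1_norm \<eta> (\<lambda>n. if n < N then 0 else s n)) \<longlonglongrightarrow> 0"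
proof -
  have c0: "s \<in> c0_space" and sum: "summable (weighted_l1_term \<eta> s)"
    using s by (auto simp: weighted_l1_space_def)
  have bs: "Bseq (\<lambda>n. if n < N then 0 else s n)" for N
    by (rule Bseq_eventually_mono[OF _ c0_space_Bseq[OF c0]]) auto
  have "(\<lambda>N. \<Sum>i. weighted_l1_term \<eta> (\<lambda>n. if n < N then 0 else s n) i) \<longlonglongrightarrow> (\<Sum>i. 0)"
  \<comment> \<open>Tannery's theorem is dominated convergence for series: each term of the tails
    tends to 0 and is dominated by the corresponding summable term of \<open>s\<close>.\<close>
  proof (rule tannerys_theorem[where M = "weighted_l1_term \<eta> s", THEN conjunct2, THEN conjunct2])
    show "(\<lambda>N. weighted_l1_term \<eta> (\<lambda>n. if n < N then 0 else s n) i) \<longlonglongrightarrow> 0" for i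
      unfolding weighted_l1_term_def
      by (rule tendsto_mult_left_zero[OF decreasing_rearrangement_tendsto_0[OF c0]]) simp
    have "weighted_l1_term \<eta> (\<lambda>n. if n < N then 0 else s n) i \<le> weighted_l1_term \<eta> s i" for N i
      by (rule weighted_l1_term_mono[OF c0_space_Bseq[OF c0] _ \<eta>]) auto
    then show "eventually (\<lambda>(i, N). norm (weighted_l1_term \<eta> (\<lambda>n. if n < N then 0 else s n) i)
        \<le> weighted_l1_term \<eta> s i) (at_top \<times>\<^sub>F sequentially)"
      using weighted_l1_term_nonneg[OF bs \<eta>]
      by (intro always_eventually) auto
  qed (use sum in auto)
  then show ?thesis
    by (simp add: weighted_l1_norm_def)
qed

section \<open>Expansions\<close>

text \<open>Summing over a common finite superset of the supports allows expansions of different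
  sequences to be combined termwise.\<close>

lemma finite_expansion_eq_sum:
  assumes "normed_space_over smul" "finite F" "\<And>n. n \<notin> F \<Longrightarrow> a n = 0"
  shows "finite_expansion smul e a = (\<Sum>n\<in>F. smul (a n) (e n))"
proof -
  interpret normed_space_over smul by fact
  show ?thesis
    unfolding finite_expansion_def using assms(2,3) by (intro sum.mono_neutral_left) auto
qed

lemma biorthogonal_finite_expansion:
  assumes "biorthogonal_system smul e e'" "a \<in> c00_space"
  shows "blinfun_apply (e' n) (finite_expansion smul e a) = a n"
proof -
  have "blinfun_apply (e' n) (finite_expansion smul e a) =
      (\<Sum>m\<in>{m. a m \<noteq> 0}. a m * (if n = m then 1 else 0))"
    unfolding finite_expansion_def using assms(1)
    by (auto simp: blinfun.sum_right biorthogonal_system_def dual_space_def intro!: sum.cong)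
  also have "\<dots> = a n"
    using assms(2) by (auto simp: c00_space_def sum.delta' if_distrib cong: if_cong)
  finally show ?thesis .
qed

lemma norm_finite_expansion_le:
  fixes smul :: "'k::real_normed_field \<Rightarrow> 'a::real_normed_vector \<Rightarrow> 'a"
  assumes smul: "normed_space_over smul" and \<eta>: "\<eta> 0 = 0"
    and bound: "\<And>A \<epsilon>. finite A \<Longrightarrow> \<epsilon> \<in> unimodular_sequences \<Longrightarrow>
      norm (indicator_sum smul e \<epsilon> A) \<le> \<eta> (card A)"
    and "a \<in> c00_space"
  shows "norm (finite_expansion smul e a) \<le> weighted_l1_norm \<eta> a"
  using assms(4)
\<comment> \<open>Strong induction on the support size: several entries may share the least modulus
  and vanish together.\<close>
proof (induction "card {n. a n \<noteq> 0}" arbitrary: a rule: less_induct)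
  case less
  interpret normed_space_over smul by fact
  let ?A = "{n. a n \<noteq> 0}"
  have fin: "finite ?A"
    using less.prems by (simp add: c00_space_def)
  show ?case
  proof (cases "?A = {}")
    case True
    then show ?thesis
      using weighted_l1_norm_c00[OF less.prems, of 0] by (simp add: finite_expansion_def)
  next
    case False
    define m where "m = Min ((\<lambda>n. norm (a n)) ` ?A)"
    \<comment> \<open>An index \<open>k\<close> attaining the minimum satisfies
      \<open>b k = 0\<close>, which makes the inclusion of supports strict.\<close>
    have "m \<in> (\<lambda>n. norm (a n)) ` ?A"
      unfolding m_def using fin False by (intro Min_in) auto
    then obtain k where k: "a k \<noteq> 0" "norm (a k) = m"
      by auto
    then have m: "0 < m"
      by auto
    have ge: "m \<le> norm (a n)" if "a n \<noteq> 0" for n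
      unfolding m_def using fin that by (intro Min_le) auto
    define b where "b n = (norm (a n) - m) *\<^sub>R sgn (a n)" for n
    \<comment> \<open>The value 1 off the support keeps \<open>\<epsilon>\<close> unimodular, as
      \<open>sgn 0 = 0\<close>; the indicator sum over \<open>?A\<close> never sees it.\<close>
    define \<epsilon> where "\<epsilon> n = (if a n = 0 then 1 else sgn (a n))" for n
    have sub: "{n. b n \<noteq> 0} \<subset> ?A"
      using k by (auto simp: b_def sgn_zero_iff)
    have b: "b \<in> c00_space"
      using fin sub finite_subset by (auto simp: c00_space_def)
    have nb: "norm (b n) = (if a n = 0 then 0 else norm (a n) - m)" for n
      using ge[of n] by (simp add: b_def norm_sgn)
    have \<epsilon>: "\<epsilon> \<in> unimodular_sequences"
      by (simp add: unimodular_sequences_def \<epsilon>_def norm_sgn)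
    have ab: "smul (a n) (e n) = smul (b n) (e n) + m *\<^sub>R smul (\<epsilon> n) (e n)" if "a n \<noteq> 0" for n
    proof -
      have "a n = b n + of_real m * \<epsilon> n"
        using that by (simp add: b_def \<epsilon>_def sgn_div_norm scaleR_conv_of_real field_simps)
      then show ?thesis
        by (metis scale_left_distrib scale_scale scale_of_real)
    qed
    have "finite_expansion smul e a = finite_expansion smul e b + m *\<^sub>R indicator_sum smul e \<epsilon> ?A"
    proof -
      have "finite_expansion smul e a = (\<Sum>n\<in>?A. smul (b n) (e n) + m *\<^sub>R smul (\<epsilon> n) (e n))"
        unfolding finite_expansion_def by (intro sum.cong ab) auto
      also have "\<dots> = (\<Sum>n\<in>?A. smul (b n) (e n)) + m *\<^sub>R indicator_sum smul e \<epsilon> ?A"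
        by (simp add: sum.distrib indicator_sum_def scaleR_sum_right)
      also have "(\<Sum>n\<in>?A. smul (b n) (e n)) = finite_expansion smul e b"
        using smul fin by (intro finite_expansion_eq_sum[symmetric]) (auto simp: b_def)
      finally show ?thesis .
    qed
    then have "norm (finite_expansion smul e a) \<le>
        norm (finite_expansion smul e b) + m * norm (indicator_sum smul e \<epsilon> ?A)"
      using norm_triangle_ineq[of "finite_expansion smul e b" "m *\<^sub>R indicator_sum smul e \<epsilon> ?A"] m
      by simp
    also have "\<dots> \<le> weighted_l1_norm \<eta> b + m * \<eta> (card ?A)"
      using less.hyps[OF psubset_card_mono[OF fin sub] b] bound[OF fin \<epsilon>] m
      by (intro add_mono mult_left_mono) auto
    also have "\<dots> = weighted_l1_norm \<eta> a"
      using weighted_l1_norm_peel[where \<eta> = \<eta>, OF less.prems b m ge nb \<eta>] by simp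
    finally show ?thesis .
  qed
qed

text \<open>The partial sums form a Cauchy sequence, and completeness supplies the limit
  \<open>x\<close>. Continuity of the functionals and of the norm carries the coefficients and the
  bound over to \<open>x\<close>. Uniqueness is left to the totality argument.\<close>

lemma expansion_exists:
  fixes smul :: "'k::real_normed_field \<Rightarrow> 'a::banach \<Rightarrow> 'a"
  assumes smul: "normed_space_over smul" and bi: "biorthogonal_system smul e e'"
    and \<eta>: "\<And>j. 1 \<le> j \<Longrightarrow> 0 \<le> backward_difference \<eta> j"
    and bound: "\<And>a. a \<in> c00_space \<Longrightarrow> norm (finite_expansion smul e a) \<le> weighted_l1_norm \<eta> a"
    and s: "s \<in> weighted_l1_space \<eta>"
  obtains x where "\<And>n. blinfun_apply (e' n) x = s n" "norm x \<le> weighted_l1_norm \<eta> s"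
proof -
  define P where "P N = finite_expansion smul e (\<lambda>n. if n < N then s n else 0)" for N
  interpret normed_space_over smul by fact
  define T where "T N n = (if n < N then 0 else s n)" for N n
  have T: "T N \<in> weighted_l1_space \<eta>" for N
    by (rule weighted_l1_space_mono(1)[OF s _ \<eta>]) (auto simp: T_def)
  have fin: "(\<lambda>n. if n < N then T M n else 0) \<in> c00_space" for N M
    by (auto simp: c00_space_def intro: finite_subset[of _ "{..<N}"])
  \<comment> \<open>The difference is the finite expansion of the tail \<open>T M\<close> cut off at
    \<open>N\<close>. The bound on \<open>c00_space\<close> applies to it, and restoring the cut-off
    entries only increases the weighted norm.\<close>
  have diff: "norm (P N - P M) \<le> weighted_l1_norm \<eta> (T M)" if "M \<le> N" for M N
  proof -
    have "P N - P M = finite_expansion smul e (\<lambda>n. if n < N then T M n else 0)"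
    proof -
      have "P N - P M = (\<Sum>n<N. smul (if n < N then s n else 0) (e n)) -
          (\<Sum>n<N. smul (if n < M then s n else 0) (e n))"
        unfolding P_def using that by (intro arg_cong2[where f = "(-)"] finite_expansion_eq_sum[OF smul]) auto
      also have "\<dots> = (\<Sum>n<N. smul (if n < N then T M n else 0) (e n))"
        unfolding sum_subtractf[symmetric] by (intro sum.cong) (auto simp: T_def)
      also have "\<dots> = finite_expansion smul e (\<lambda>n. if n < N then T M n else 0)"
        by (intro finite_expansion_eq_sum[OF smul, symmetric]) auto
      finally show ?thesis .
    qed
    also have "norm \<dots> \<le> weighted_l1_norm \<eta> (\<lambda>n. if n < N then T M n else 0)"
      by (rule bound[OF fin])
    also have "\<dots> \<le> weighted_l1_norm \<eta> (T M)"
      by (rule weighted_l1_space_mono(2)[OF T _ \<eta>]) auto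
    finally show ?thesis .
  qed
  have "Cauchy P"
  proof (rule CauchyI)
    fix u :: real assume "0 < u"
    then have "eventually (\<lambda>M. weighted_l1_norm \<eta> (T M) < u / 2) sequentially"
      using order_tendstoD(2)[OF weighted_l1_norm_tail_tendsto_0[OF s \<eta>], of "u / 2"]
      by (simp add: T_def[abs_def])
    then obtain M where M: "weighted_l1_norm \<eta> (T M) < u / 2"
      by (auto simp: eventually_sequentially)
    have "norm (P m - P n) < u" if "m \<ge> M" "n \<ge> M" for m n
      using norm_triangle_ineq4[of "P m - P M" "P n - P M"] diff[OF that(1)] diff[OF that(2)] M
      by simp
    then show "\<exists>M. \<forall>m\<ge>M. \<forall>n\<ge>M. norm (P m - P n) < u"
      by blast
  qed
  then obtain x where x: "P \<longlonglongrightarrow> x"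
    by (auto simp: Cauchy_convergent_iff convergent_def)
  have P_c00: "(\<lambda>n. if n < N then s n else 0) \<in> c00_space" for N
    by (auto simp: c00_space_def intro: finite_subset[of _ "{..<N}"])
  show thesis
  proof
    show "blinfun_apply (e' n) x = s n" for n
    proof (rule LIMSEQ_unique)
      show "(\<lambda>N. blinfun_apply (e' n) (P N)) \<longlonglongrightarrow> blinfun_apply (e' n) x"
        by (intro tendsto_intros x)
      \<comment> \<open>As soon as \<open>N > n\<close>, the partial sum already has the final
        \<open>n\<close>-th coefficient.\<close>
      have "eventually (\<lambda>N. blinfun_apply (e' n) (P N) = s n) sequentially"
        using eventually_gt_at_top[of n]
        by eventually_elim (simp add: P_def biorthogonal_finite_expansion[OF bi P_c00])
      then show "(\<lambda>N. blinfun_apply (e' n) (P N)) \<longlonglongrightarrow> s n"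
        by (rule tendsto_eventually)
    qed
    have "norm (P N) \<le> weighted_l1_norm \<eta> s" for N
      unfolding P_def using bound[OF P_c00]
      by (rule order_trans) (rule weighted_l1_space_mono(2)[OF s _ \<eta>], auto)
    then show "norm x \<le> weighted_l1_norm \<eta> s"
      using Lim_bounded[OF tendsto_norm[OF x]] by blast
  qed
qed

section \<open>The equivalences\<close>

theorem theorem1p2:
  fixes smul :: "'k::real_normed_field \<Rightarrow> 'a::banach \<Rightarrow> 'a"
    and e :: "nat \<Rightarrow> 'a"
    and e' :: "nat \<Rightarrow> 'a \<Rightarrow>\<^sub>L 'k"
    and \<eta> :: "nat \<Rightarrow> real"
  assumes "separable_infinite_dim_space smul"
    and "biorthogonal_system smul e e'"
    and "seminormalized e e'"
    and "\<eta> 0 = 0"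
    and "\<forall>j\<ge>1. 0 < \<eta> j"
    and "\<forall>i j. 1 \<le> i \<longrightarrow> i \<le> j \<longrightarrow> \<eta> i \<le> \<eta> j"
  shows
    "((\<forall>A. finite A \<longrightarrow> (\<forall>\<epsilon>\<in>unimodular_sequences. norm (indicator_sum smul e \<epsilon> A) \<le> \<eta> (card A))) \<longleftrightarrow>
      (\<forall>a\<in>c00_space. norm (finite_expansion smul e a) \<le> weighted_l1_norm \<eta> a)) \<and>
     (total_functionals e' \<longrightarrow>
       ((\<forall>A. finite A \<longrightarrow> (\<forall>\<epsilon>\<in>unimodular_sequences. norm (indicator_sum smul e \<epsilon> A) \<le> \<eta> (card A))) \<longleftrightarrow>
        embeds_with_norm_one \<eta> e') \<and>
       ((\<forall>a\<in>c00_space. norm (finite_expansion smul e a) \<le> weighted_l1_norm \<eta> a) \<longleftrightarrow>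
        embeds_with_norm_one \<eta> e'))"
    (is "(?i \<longleftrightarrow> ?ii) \<and> (?total \<longrightarrow> (?i \<longleftrightarrow> ?iii) \<and> (?ii \<longleftrightarrow> ?iii))")
proof -
  have smul: "normed_space_over smul"
    using assms(1) by (simp add: separable_infinite_dim_space_def)
  have \<eta>: "0 \<le> backward_difference \<eta> j" if "1 \<le> j" for j
  \<comment> \<open>Monotonicity is given from index 1 on; the first difference is
    \<open>\<eta> 1 - 0\<close> and is covered by positivity.\<close>
  proof (cases "j = 1")
    case True
    then show ?thesis
      using assms(4,5) by (simp add: backward_difference_def less_imp_le)
  next
    case False
    then have "1 \<le> j - 1"
      using that by simp
    then show ?thesis
      using assms(6) by (simp add: backward_difference_def)
  qed
  have "?i \<Longrightarrow> ?ii"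
    using norm_finite_expansion_le[where \<eta> = \<eta> and e = e, OF smul assms(4)] by blast
  moreover have "?i" if ii: "?ii"
  proof (intro allI impI ballI)
    fix A :: "nat set" and \<epsilon> :: "nat \<Rightarrow> 'k"
    assume A: "finite A" and \<epsilon>: "\<epsilon> \<in> unimodular_sequences"
    \<comment> \<open>Cutting the signs off outside \<open>A\<close> gives a test sequence for (ii)
      whose expansion is the indicator sum and whose weighted norm is exactly
      \<open>\<eta> (card A)\<close>.\<close>
    let ?a = "\<lambda>n. if n \<in> A then \<epsilon> n else 0"
    have "?a \<in> c00_space"
      using A by (simp add: c00_space_def)
    moreover have "finite_expansion smul e ?a = indicator_sum smul e \<epsilon> A"
      using finite_expansion_eq_sum[OF smul A, of ?a] by (simp add: indicator_sum_def)
    ultimately show "norm (indicator_sum smul e \<epsilon> A) \<le> \<eta> (card A)"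
      using ii weighted_l1_norm_const_on[where \<eta> = \<eta>, OF A \<epsilon> assms(4)] by metis
  qed
  moreover have "?iii" if total: "?total" and ii: "?ii"
    unfolding embeds_with_norm_one_def
  proof
    fix s :: "nat \<Rightarrow> 'k"
    assume s: "s \<in> weighted_l1_space \<eta>"
    obtain x where x: "\<And>n. blinfun_apply (e' n) x = s n" "norm x \<le> weighted_l1_norm \<eta> s"
      using expansion_exists[OF smul assms(2) \<eta> _ s] ii by blast
    \<comment> \<open>Totality makes the constructed vector the only one with coefficients
      \<open>s\<close>, so its norm bound holds for every such vector.\<close>
    have "y = x" if "\<forall>n. blinfun_apply (e' n) y = s n" for y
    proof -
      have "\<forall>n. blinfun_apply (e' n) (y - x) = 0"
        using that x(1) by (simp add: blinfun.diff_right)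
      then show ?thesis
        using total unfolding total_functionals_def by (metis eq_iff_diff_eq_0)
    qed
    then show "(\<exists>!x. \<forall>n. blinfun_apply (e' n) x = s n) \<and>
        (\<forall>x. (\<forall>n. blinfun_apply (e' n) x = s n) \<longrightarrow> norm x \<le> weighted_l1_norm \<eta> s)"
      using x by blast
  qed
  \<comment> \<open>The finite expansion of \<open>a\<close> is a vector with coefficients
    \<open>a\<close>, and \<open>a\<close> lies in the weighted space, so the norm bound in (iii)
    applies to it.\<close>
  moreover have "?iii \<Longrightarrow> ?ii"
    using biorthogonal_finite_expansion[OF assms(2)] c00_space_subset_weighted_l1_space[of \<eta>]
    by (auto simp: embeds_with_norm_one_def)
  ultimately show ?thesis
    by blast
qed

end
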